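(* Let $p>3$ be a prime. Then $$\sum_{k=0}^{(p-1)/2}\frac{20k+3}{(-2^{10})^k}\binom{4k}{k,k,k,k}\equiv p\left(\frac{-1}{p}\right)\left(2^{p-1}+2-(2^{p-1}-1)^2\right)\pmod{p^4},$$ where $\left(\frac{\cdot}{p}\right)$ is the Legendre symbol.
   Context: For each nonnegative integer $k$, $\binom{4k}{k,k,k,k}=\frac{(4k)!}{(k!)^4}=\binom{4k}{2k}\binom{2k}{k}^2$. For rational numbers $a,b$ whose denominators are prime to $p$, $a\equiv b\pmod{p^m}$ means that $a-b$ is $p^m$ times a rational number with denominator prime to $p$. One has $\left(\frac{-1}{p}\right)=(-1)^{(p-1)/2}$. *)

theory Defs
  imports "HOL-Number_Theory.Number_Theory"
begin

text \<open>\<open>quotient_of\<close> yields numerator and (positive) denominator in lowest terms.\<close>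

definition p_integral :: "nat \<Rightarrow> rat \<Rightarrow> bool" where
  "p_integral p r \<longleftrightarrow> coprime (snd (quotient_of r)) (int p)"

text \<open>
  \<open>rat_cong p m a b\<close> is the congruence of \<open>a\<close> and \<open>b\<close> modulo \<open>p ^ m\<close>. It is
  meant for \<open>p\<close>-integral arguments only, so integrality of both sides is made part of
  the relation.
\<close>

definition rat_cong :: "nat \<Rightarrow> nat \<Rightarrow> rat \<Rightarrow> rat \<Rightarrow> bool" where
  "rat_cong p m a b \<longleftrightarrow> p_integral p a \<and> p_integral p b \<and>
     (\<exists>c. p_integral p c \<and> a - b = of_nat p ^ m * c)"

definition multinomial4 :: "nat \<Rightarrow> rat" where
  "multinomial4 k = fact (4 * k) / fact k ^ 4"

end

theory Submission
  imports Defs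
begin

text \<open>
  The summand is the line \<open>k = 0\<close> of a Wilf--Zeilberger pair \<open>(F, G)\<close> in which
  \<open>F n k\<close> vanishes for \<open>n < k\<close>. With \<open>N = (p - 1) / 2\<close>, shifting \<open>k\<close> from \<open>0\<close> to \<open>N\<close> therefore
  turns the sum into \<open>F N N\<close> plus the boundary terms \<open>G (N + 1) k\<close> for \<open>k < N\<close>.
  Morley's congruence \<open>(-1)^N binomial (p - 1) N = 4^(p - 1)\<close> modulo \<open>p^3\<close> gives
  \<open>F N N = 3 p (-1)^N\<close> modulo \<open>p^4\<close>. The boundary terms are \<open>p^2\<close> times a common factor times
  \<open>(1/2 + p)_k (-1/2 - p/2)_k / (1/2)_k^2\<close>, which modulo \<open>p^2\<close> is linear in odd harmonic
  numbers; their sum is thus a quadratic polynomial in the harmonic number \<open>H_N\<close>, and \<open>H_N\<close> is known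
  modulo \<open>p^2\<close> in terms of the Fermat quotient of \<open>2\<close>.
\<close>

section \<open>The Wilf--Zeilberger pair\<close>

text \<open>The falling factorial \<open>n! / (n - k)!\<close> appears as
  \<open>of_nat (n choose k) * fact k\<close>, which makes the vanishing for \<open>n < k\<close>
  automatic and avoids truncated subtraction.\<close>

definition wz_F :: "nat \<Rightarrow> nat \<Rightarrow> rat" where
  "wz_F n k = (-1) ^ (n + k) * (20 * of_nat n - 2 * of_nat k + 3) / 16 ^ n
     * pochhammer (1/2) n * pochhammer (1/2) (2 * n + k) * of_nat (n choose k) * fact k
     / (fact n ^ 3 * pochhammer (1/2) k ^ 2)"

text \<open>The factor \<open>of_nat n ^ 2\<close> makes \<open>wz_G 0 k\<close> vanish, so
  telescoping over \<open>n\<close> leaves only the upper boundary term.\<close>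

definition wz_G :: "nat \<Rightarrow> nat \<Rightarrow> rat" where
  "wz_G n k = 32 * (-1) ^ (n + k + 1) / 16 ^ n
     * pochhammer (1/2) n * pochhammer (1/2) (2 * n + k) * of_nat n ^ 2
     * of_nat (n choose Suc k) * fact (Suc k)
     / (fact n ^ 3 * pochhammer (1/2) (Suc k) ^ 2)"

lemma pochhammer_half_pos: "pochhammer (1/2 :: rat) n > 0"
  by (rule pochhammer_pos) simp

text \<open>All four terms are one hypergeometric factor \<open>W\<close> times a polynomial in
  \<open>n\<close> and \<open>k\<close>, which reduces the claim to a polynomial identity.\<close>

lemma wz_pair: "wz_F n k - wz_F n (Suc k) = wz_G (Suc n) k - wz_G n k"
proof -
  define c where "c = (of_nat (n choose k) :: rat)"
  define x where "x = (of_nat n :: rat)"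
  define y where "y = (of_nat k :: rat)"
  define s where "s = ((-1) ^ (n + k) :: rat)"
  define r where "r = pochhammer (1/2 :: rat) n"
  define t where "t = pochhammer (1/2 :: rat) (2 * n + k)"
  define u where "u = pochhammer (1/2 :: rat) k"
  define f where "f = (fact n :: rat)"
  define h where "h = (fact k :: rat)"
  define S where "S = (16 ^ n :: rat)"
  have nz: "u \<noteq> 0" "f \<noteq> 0" "S \<noteq> 0" "x + 1 \<noteq> 0" "2 * y + 1 \<noteq> 0" "h \<noteq> 0" "y + 1 \<noteq> 0"
    unfolding u_def f_def S_def x_def y_def h_def
    using pochhammer_half_pos[of k] by (simp_all add: add_eq_0_iff_both_eq_0 add.commute)
  have c1: "of_nat (n choose Suc k) = c * (x - y) / (y + 1)"
  proof -
    have "of_nat (Suc k * (n choose Suc k)) = (of_nat (n - k) * c :: rat)"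
      by (metis binomial_absorb_comp binomial_absorption c_def mult.commute of_nat_mult)
    \<comment> \<open>For \<open>k > n\<close> the truncated \<open>n - k\<close> does no harm,
      since then \<open>c = 0\<close>.\<close>
    also have "\<dots> = (x - y) * c"
      by (cases "k \<le> n") (auto simp: c_def x_def y_def of_nat_diff binomial_eq_0)
    finally show ?thesis using nz by (simp add: field_simps y_def)
  qed
  have c2: "of_nat (Suc n choose Suc k) = c * (x + 1) / (y + 1)"
  proof -
    have "of_nat (Suc k * (Suc n choose Suc k)) = (of_nat (Suc n * (n choose k)) :: rat)"
      by (metis Suc_times_binomial_eq mult.commute)
    then show ?thesis using nz by (simp add: field_simps y_def c_def x_def del: binomial_Suc_Suc)
  qed
  have t1: "pochhammer (1/2 :: rat) (2 * n + Suc k) = t * (1/2 + 2 * x + y)"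
    by (simp add: t_def x_def y_def pochhammer_Suc algebra_simps)
  have t2: "pochhammer (1/2 :: rat) (2 * Suc n + k) = t * (1/2 + 2 * x + y) * (3/2 + 2 * x + y)"
    by (simp add: t_def x_def y_def pochhammer_Suc algebra_simps)
  have r1: "pochhammer (1/2 :: rat) (Suc n) = r * (1/2 + x)"
    by (simp add: r_def x_def pochhammer_Suc)
  have u1: "pochhammer (1/2 :: rat) (Suc k) = u * (1/2 + y)"
    by (simp add: u_def y_def pochhammer_Suc)
  have f1: "fact (Suc n) = (x + 1) * f" "fact (Suc k) = (y + 1) * h"
    by (simp_all add: f_def x_def y_def h_def add.commute)
  have p1: "(-1 :: rat) ^ (n + Suc k) = - s" "(-1 :: rat) ^ (n + k + 1) = - s"
     "(-1 :: rat) ^ (Suc n + k + 1) = s" "(16 :: rat) ^ Suc n = 16 * S"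
     "of_nat (Suc n) = x + 1" "of_nat (Suc k) = y + 1"
    by (simp_all add: s_def S_def x_def y_def)
  define v where "v = 1/2 + y"
  have v: "v \<noteq> 0" using nz by (simp add: v_def field_simps)
  \<comment> \<open>The extra \<open>v ^ 2\<close> in the denominator comes from
    \<open>pochhammer (1/2) (Suc k) ^ 2\<close>, which occurs in all terms except
    \<open>wz_F n k\<close>.\<close>
  define W where "W = s * r * t * c * h / (f ^ 3 * u ^ 2 * S * v ^ 2)"
  have "wz_F n k = s * (20 * x - 2 * y + 3) / S * r * t * c * h / (f ^ 3 * u ^ 2)"
    by (simp add: wz_F_def s_def x_def y_def S_def r_def t_def c_def h_def f_def u_def)
  then have F0: "wz_F n k = W * ((20 * x - 2 * y + 3) * v ^ 2)"
    using v by (simp add: W_def mult_ac)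
  have "wz_F n (Suc k) = - s * (20 * x - 2 * (y + 1) + 3) / S * r * (t * (2 * x + v)) *
      (c * (x - y) / (y + 1)) * ((y + 1) * h) / (f ^ 3 * (u * v) ^ 2)"
    unfolding wz_F_def c1 t1 u1 f1 p1 v_def by (simp add: x_def S_def r_def f_def algebra_simps)
  then have F1: "wz_F n (Suc k) = - W * ((20 * x - 2 * y + 1) * (2 * x + v) * (x - y))"
    using nz v by (simp add: W_def power_mult_distrib mult_ac)
  have "wz_G n k = 32 * (- s) / S * r * t * x ^ 2 * (c * (x - y) / (y + 1)) * ((y + 1) * h)
      / (f ^ 3 * (u * v) ^ 2)"
    unfolding wz_G_def c1 u1 f1 p1 v_def by (simp add: x_def S_def r_def f_def t_def)
  then have G0: "wz_G n k = - W * (32 * x ^ 2 * (x - y))"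
    using nz v by (simp add: W_def power_mult_distrib mult_ac)
  have "wz_G (Suc n) k = 32 * s / (16 * S) * (r * (1/2 + x)) *
      (t * (2 * x + v) * (2 * x + v + 1)) * (x + 1) ^ 2 * (c * (x + 1) / (y + 1)) * ((y + 1) * h)
      / (((x + 1) * f) ^ 3 * (u * v) ^ 2)"
    unfolding wz_G_def c2 u1 f1 p1 r1 t2 v_def by (simp add: algebra_simps)
  also have "\<dots> = W * (2 * (1/2 + x) * (2 * x + v) * (2 * x + v + 1)) * ((x + 1) ^ 3 / (x + 1) ^ 3)
      * ((y + 1) / (y + 1))"
    by (simp add: W_def power_mult_distrib power2_eq_square power3_eq_cube mult_ac)
  finally have G1: "wz_G (Suc n) k = W * (2 * (1/2 + x) * (2 * x + v) * (2 * x + v + 1))"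
    using nz by simp
  show ?thesis
    unfolding F0 F1 G0 G1 v_def by (simp add: field_simps power2_eq_square)
qed

lemma sum_wz_F:
  "(\<Sum>n\<le>N. wz_F n 0) = (\<Sum>n\<le>N. wz_F n m) + (\<Sum>k<m. wz_G (Suc N) k)"
proof (induction m)
  case (Suc m)
  have "(\<Sum>n\<le>N. wz_F n m) - (\<Sum>n\<le>N. wz_F n (Suc m)) = wz_G (Suc N) m - wz_G 0 m"
    unfolding sum_subtractf[symmetric] wz_pair
    using sum_telescope[of "\<lambda>n. - wz_G n m" N] by simp
  then show ?case using Suc by (simp add: wz_G_def algebra_simps)
qed simp

lemma sum_wz_F_diag: "(\<Sum>n\<le>N. wz_F n N) = wz_F N N"
proof -
  have "(\<Sum>n<N. wz_F n N) = 0"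
    by (rule sum.neutral) (auto simp: wz_F_def binomial_eq_0)
  then show ?thesis by (simp flip: lessThan_Suc_atMost)
qed

text \<open>The duplication formula is applied to \<open>fact (4 * k)\<close> and then to
  \<open>fact (2 * k)\<close>. It produces \<open>16 ^ k * 4 ^ k\<close>, so that of
  \<open>2 ^ (10 * k)\<close> only \<open>16 ^ k\<close> survives.\<close>

lemma wz_F_0: "wz_F k 0 = (20 * of_nat k + 3) / (- (2 ^ 10)) ^ k * multinomial4 k"
proof -
  have "(20 * of_nat k + 3) / (- (2 ^ 10)) ^ k * multinomial4 k
      = (20 * of_nat k + 3) * fact (4 * k) / ((-1) ^ k * 16 ^ k * 4 ^ k * 16 ^ k * fact k ^ 4)"
    by (simp add: multinomial4_def flip: power_mult_distrib)
  also have "fact (4 * k) = (16 ^ k * pochhammer (1/2) (2 * k) * (4 ^ k * pochhammer (1/2) k * fact k) :: rat)"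
    using fact_double[of "2 * k", where 'a = rat] fact_double[of k, where 'a = rat]
    by (simp add: power_mult)
  also have "(20 * of_nat k + 3) * \<dots> / ((-1) ^ k * 16 ^ k * 4 ^ k * 16 ^ k * fact k ^ 4) =
      (20 * of_nat k + 3) / (-1) ^ k / 16 ^ k * pochhammer (1/2) k * pochhammer (1/2) (2 * k) / fact k ^ 3"
    by (simp add: eval_nat_numeral mult_ac)
  also have "\<dots> = wz_F k 0"
    by (cases "even k") (simp_all add: wz_F_def)
  finally show ?thesis ..
qed

section \<open>Congruences between rationals modulo prime powers\<close>

text \<open>The reduced denominator divides every other denominator. Fractions need not be reduced
  any more, which makes the closure properties below easy.\<close>

lemma p_integral_iff:
  assumes "prime p"
  shows "p_integral p r \<longleftrightarrow> (\<exists>a b. \<not> int p dvd b \<and> r = of_int a / of_int b)"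
proof
  assume *: "p_integral p r"
  obtain a b where ab: "quotient_of r = (a, b)" by (cases "quotient_of r")
  have "\<not> int p dvd b"
    using * ab assms by (metis coprime_absorb_right coprime_commute not_prime_unit p_integral_def
      prime_nat_int_transfer snd_conv)
  moreover have "r = of_int a / of_int b" using ab by (rule quotient_of_div)
  ultimately show "\<exists>a b. \<not> int p dvd b \<and> r = of_int a / of_int b" by blast
next
  assume "\<exists>a b. \<not> int p dvd b \<and> r = of_int a / of_int b"
  then obtain a b where ab: "\<not> int p dvd b" "r = of_int a / of_int b" by blast
  obtain c d where cd: "quotient_of r = (c, d)" by (cases "quotient_of r")
  have d: "d > 0" and co: "coprime c d" and r: "r = of_int c / of_int d"
    using cd quotient_of_denom_pos quotient_of_coprime quotient_of_div by blast+
  have b: "b \<noteq> 0" using ab by auto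
  have "of_int (a * d) = (of_int (c * b) :: rat)"
    using ab(2) r b d by (simp add: field_simps)
  then have "a * d = c * b" by (simp only: of_int_eq_iff)
  then have "d dvd b" using co by (metis coprime_commute coprime_dvd_mult_right_iff dvd_triv_right)
  then have "\<not> int p dvd d" using ab(1) dvd_trans by blast
  then have "coprime d (int p)"
    using assms prime_imp_coprime[of "int p" d] by (simp add: coprime_commute)
  then show "p_integral p r" by (simp add: p_integral_def cd)
qed

locale prime_gt_3 =
  fixes p :: nat
  assumes prime: "prime p" and gt3: "p > 3"
begin

abbreviation Zp :: "rat \<Rightarrow> bool" where "Zp \<equiv> p_integral p"
abbreviation P :: rat where "P \<equiv> of_nat p"

lemma p_nonzero [simp]: "p \<noteq> 0" using gt3 by simp

lemma Zp_div: "\<not> int p dvd b \<Longrightarrow> Zp (of_int a / of_int b)"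
  using p_integral_iff[OF prime] by blast

lemma Zp_of_int [simp, intro]: "Zp (of_int a)"
  using Zp_div[of 1 a] gt3 by simp

lemma Zp_of_nat [simp, intro]: "Zp (of_nat a)"
  using Zp_of_int[of "int a"] by simp

lemma Zp_simple [simp, intro]: "Zp 0" "Zp 1" "Zp (numeral w)"
  using Zp_of_int[of 0] Zp_of_int[of 1] Zp_of_int[of "numeral w"] by simp_all

lemma Zp_mult [intro]:
  assumes "Zp x" "Zp y" shows "Zp (x * y)"
proof -
  obtain a b c d where "\<not> int p dvd b" "x = of_int a / of_int b" "\<not> int p dvd d" "y = of_int c / of_int d"
    using assms p_integral_iff[OF prime] by metis
  then have "\<not> int p dvd b * d" "x * y = of_int (a * c) / of_int (b * d)"
    using prime by (auto simp: prime_dvd_mult_iff)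
  then show ?thesis using Zp_div by metis
qed

lemma Zp_add [intro]:
  assumes "Zp x" "Zp y" shows "Zp (x + y)"
proof -
  obtain a b c d where *: "\<not> int p dvd b" "x = of_int a / of_int b" "\<not> int p dvd d" "y = of_int c / of_int d"
    using assms p_integral_iff[OF prime] by metis
  moreover from * have "b \<noteq> 0" "d \<noteq> 0" by auto
  ultimately have "\<not> int p dvd b * d" "x + y = of_int (a * d + c * b) / of_int (b * d)"
    using prime by (auto simp: prime_dvd_mult_iff field_simps)
  then show ?thesis using Zp_div by metis
qed

lemma Zp_uminus [intro]: "Zp x \<Longrightarrow> Zp (- x)"
  using Zp_mult[of "of_int (-1)" x] Zp_of_int[of "-1"] by simp

lemma Zp_diff [intro]: "Zp x \<Longrightarrow> Zp y \<Longrightarrow> Zp (x - y)"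
  using Zp_add[of x "- y"] by auto

lemma Zp_power [intro]: "Zp x \<Longrightarrow> Zp (x ^ n)"
  by (induction n) auto

lemma Zp_sum [intro]: "(\<And>i. i \<in> A \<Longrightarrow> Zp (f i)) \<Longrightarrow> Zp (sum f A)"
  by (induction A rule: infinite_finite_induct) auto

lemmas Zp_intros = Zp_simple Zp_of_nat Zp_of_int Zp_add Zp_mult Zp_diff Zp_uminus Zp_power

lemma Zp_divide_of_nat: "Zp x \<Longrightarrow> \<not> p dvd n \<Longrightarrow> Zp (x / of_nat n)"
  using Zp_mult[of x "1 / of_nat n"] Zp_div[of "int n" 1] by simp

lemma Zp_divide_less: "Zp x \<Longrightarrow> 0 < n \<Longrightarrow> n < p \<Longrightarrow> Zp (x / of_nat n)"
  by (rule Zp_divide_of_nat) (auto dest: dvd_imp_le)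

lemma Zp_divide_2: "Zp x \<Longrightarrow> Zp (x / 2)"
  using Zp_divide_less[of x 2] gt3 by simp

lemma Zp_divide_power_2: "Zp x \<Longrightarrow> Zp (x / 2 ^ n)"
  by (induction n arbitrary: x)
    (auto simp flip: divide_divide_eq_left intro: Zp_divide_2)

text \<open>Unlike \<open>rat_cong\<close>, this asks no integrality of \<open>a\<close> and
  \<open>b\<close> themselves. It is therefore additive without side conditions, and powers of
  \<open>p\<close> can be moved in and out freely.\<close>

definition pcong :: "nat \<Rightarrow> rat \<Rightarrow> rat \<Rightarrow> bool" where
  "pcong m a b \<longleftrightarrow> Zp ((a - b) / P ^ m)"

lemma pcong_refl [simp, intro]: "pcong m a a"
  by (simp add: pcong_def)

lemma pcong_sym: "pcong m a b \<Longrightarrow> pcong m b a"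
  by (metis Zp_uminus pcong_def minus_diff_eq minus_divide_left)

lemma pcong_trans [trans]: "pcong m a b \<Longrightarrow> pcong m b c \<Longrightarrow> pcong m a c"
  using Zp_add[of "(a - b) / P ^ m" "(b - c) / P ^ m"]
  by (simp add: pcong_def flip: add_divide_distrib)

lemma pcong_add: "pcong m a b \<Longrightarrow> pcong m c d \<Longrightarrow> pcong m (a + c) (b + d)"
  using Zp_add[of "(a - b) / P ^ m" "(c - d) / P ^ m"]
  by (simp add: pcong_def algebra_simps flip: add_divide_distrib)

lemma pcong_uminus: "pcong m a b \<Longrightarrow> pcong m (- a) (- b)"
  by (metis Zp_uminus pcong_def minus_diff_minus minus_divide_left)

lemma pcong_diff: "pcong m a b \<Longrightarrow> pcong m c d \<Longrightarrow> pcong m (a - c) (b - d)"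
  using pcong_add[of m a b "- c" "- d"] pcong_uminus[of m c d] by simp

lemma pcong_mult_left: "Zp c \<Longrightarrow> pcong m a b \<Longrightarrow> pcong m (c * a) (c * b)"
  using Zp_mult[of c "(a - b) / P ^ m"] by (simp add: pcong_def algebra_simps)

lemma pcong_mult_right: "Zp c \<Longrightarrow> pcong m a b \<Longrightarrow> pcong m (a * c) (b * c)"
  using pcong_mult_left[of c m a b] by (simp add: mult.commute)

lemma pcong_mult: "pcong m a b \<Longrightarrow> pcong m c d \<Longrightarrow> Zp b \<Longrightarrow> Zp c \<Longrightarrow> pcong m (a * c) (b * d)"
  using pcong_trans[OF pcong_mult_right[of c m a b] pcong_mult_left[of b m c d]] by blast

lemma pcong_power: "pcong m a b \<Longrightarrow> Zp a \<Longrightarrow> Zp b \<Longrightarrow> pcong m (a ^ n) (b ^ n)"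
  by (induction n) (auto intro!: pcong_mult)

lemma pcong_sum: "(\<And>i. i \<in> A \<Longrightarrow> pcong m (f i) (g i)) \<Longrightarrow> pcong m (sum f A) (sum g A)"
  by (induction A rule: infinite_finite_induct) (auto intro: pcong_add)

text \<open>Trades an explicit power of \<open>p\<close> for precision: a factor
  \<open>p ^ n\<close> lowers the modulus needed for the cofactor by \<open>n\<close>.\<close>

lemma pcong_shift: "pcong (m + n) (P ^ n * a) (P ^ n * b) \<longleftrightarrow> pcong m a b"
  by (simp add: pcong_def power_add flip: right_diff_distrib)

lemma pcong_weaken: "pcong m a b \<Longrightarrow> n \<le> m \<Longrightarrow> pcong n a b"
  using Zp_mult[of "P ^ (m - n)" "(a - b) / P ^ m"]
  by (auto simp: pcong_def power_add Zp_power dest: le_Suc_ex)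

lemma pcong_0_Zp: "pcong 0 a b \<Longrightarrow> Zp b \<Longrightarrow> Zp a"
  using Zp_add[of "a - b" b] by (simp add: pcong_def)

lemma Zp_of_pcong: "pcong m a b \<Longrightarrow> Zp b \<Longrightarrow> Zp a"
  using pcong_weaken[of m a b 0] pcong_0_Zp by auto

lemma pcong_witness:
  assumes "pcong m a b" obtains c where "Zp c" "a = b + P ^ m * c"
  using that[of "(a - b) / P ^ m"] assms by (simp add: pcong_def)

lemma pcongI: "Zp c \<Longrightarrow> a - b = P ^ m * c \<Longrightarrow> pcong m a b"
  by (simp add: pcong_def)

lemma pcong_cancel:
  assumes "\<not> p dvd n" "pcong m (of_nat n * a) (of_nat n * b)"
  shows "pcong m a b"
proof -
  have "n \<noteq> 0" using assms(1) by (cases n) auto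
  then show ?thesis
    using Zp_divide_of_nat[OF assms(2)[unfolded pcong_def] assms(1)]
    by (simp add: pcong_def flip: right_diff_distrib)
qed

lemma pcong_cancel_less:
  "0 < n \<Longrightarrow> n < p \<Longrightarrow> pcong m (of_nat n * a) (of_nat n * b) \<Longrightarrow> pcong m a b"
  by (rule pcong_cancel) (auto dest: dvd_imp_le)

lemma rat_congI: "Zp b \<Longrightarrow> pcong m a b \<Longrightarrow> rat_cong p m a b"
  by (auto simp: rat_cong_def elim: pcong_witness intro: Zp_of_pcong)

text \<open>Newton's identity for the second elementary symmetric function, doubled to avoid halves.\<close>

lemma prod_one_plus_pcong:
  assumes "\<And>i. i \<in> A \<Longrightarrow> Zp (f i)"
  shows "pcong 3 (2 * (\<Prod>i\<in>A. 1 + P * f i))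
    (2 + 2 * P * sum f A + P ^ 2 * ((sum f A) ^ 2 - (\<Sum>i\<in>A. f i ^ 2)))"
  using assms
proof (induction A rule: infinite_finite_induct)
  case (insert x A)
  define s t where "s = sum f A" and "t = (\<Sum>i\<in>A. f i ^ 2)"
  have z: "Zp (f x)" "Zp s" "Zp t" using insert.prems by (auto simp: s_def t_def)
  have "pcong 3 (2 * (\<Prod>i\<in>A. 1 + P * f i)) (2 + 2 * P * s + P ^ 2 * (s ^ 2 - t))"
    unfolding s_def t_def using insert.prems by (intro insert.IH) simp
  then obtain c where c: "Zp c" "2 * (\<Prod>i\<in>A. 1 + P * f i) = 2 + 2 * P * s + P ^ 2 * (s ^ 2 - t) + P ^ 3 * c"
    by (rule pcong_witness)
  have sm: "sum f (insert x A) = f x + s" "(\<Sum>i\<in>insert x A. f i ^ 2) = f x ^ 2 + t"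
    using insert.hyps by (simp_all add: s_def t_def)
  have "2 * (\<Prod>i\<in>insert x A. 1 + P * f i) = (1 + P * f x) * (2 * (\<Prod>i\<in>A. 1 + P * f i))"
    using insert.hyps by (simp add: algebra_simps)
  then have pr: "2 * (\<Prod>i\<in>insert x A. 1 + P * f i) =
      (1 + P * f x) * (2 + 2 * P * s + P ^ 2 * (s ^ 2 - t) + P ^ 3 * c)"
    unfolding c(2) .
  show ?case
    unfolding sm pr
  proof (rule pcongI)
    \<comment> \<open>The cross term \<open>2 * P ^ 2 * f x * s\<close> is exactly the growth of
      \<open>(sum f A) ^ 2\<close> minus the sum of squares, so only multiples of
      \<open>P ^ 3\<close> remain.\<close>
    show "(1 + P * f x) * (2 + 2 * P * s + P ^ 2 * (s ^ 2 - t) + P ^ 3 * c)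
        - (2 + 2 * P * (f x + s) + P ^ 2 * ((f x + s) ^ 2 - (f x ^ 2 + t)))
      = P ^ 3 * (c + f x * (s ^ 2 - t) + P * f x * c)"
      by (simp add: algebra_simps power2_eq_square power3_eq_cube)
  qed (intro Zp_intros z c)
qed simp_all

end

section \<open>Harmonic sums and Morley's congruence\<close>

definition hsum :: "nat \<Rightarrow> nat \<Rightarrow> rat" where
  "hsum r n = (\<Sum>j=1..n. 1 / of_nat j ^ r)"

definition osum :: "nat \<Rightarrow> nat \<Rightarrow> rat" where
  "osum r n = (\<Sum>j<n. 1 / of_nat (2 * j + 1) ^ r)"

lemma hsum_double: "hsum r (2 * n) = osum r n + hsum r n / 2 ^ r"
  by (induction n)
    (auto simp: hsum_def osum_def add_divide_distrib power_mult_distrib[symmetric] algebra_simps)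

text \<open>Twice the sum of \<open>a i * a k\<close> over \<open>i \<le> k\<close> is the full
  square of the sum plus the diagonal; here \<open>a i = 1 / (2 * i + 1)\<close>.\<close>

lemma sum_osum_div:
  "2 * (\<Sum>k<n. osum 1 (Suc k) / of_nat (2 * k + 1)) = osum 1 n ^ 2 + osum 2 n"
proof (induction n)
  case (Suc n)
  define d :: rat where "d = of_nat (2 * n + 1)"
  have osum_Suc: "osum r (Suc n) = osum r n + 1 / d ^ r" for r
    by (simp add: osum_def d_def)
  have "(\<Sum>k<Suc n. osum 1 (Suc k) / of_nat (2 * k + 1)) =
      (\<Sum>k<n. osum 1 (Suc k) / of_nat (2 * k + 1)) + osum 1 (Suc n) / d"
    by (simp add: d_def)
  then show ?case
    using Suc unfolding osum_Suc by (simp add: algebra_simps power2_eq_square add_divide_distrib)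
qed (simp add: osum_def)

lemma sum_reflect:
  "(\<Sum>j=1..2*n. f j) = (\<Sum>j=1..n. f j + f (2 * n + 1 - j))" for f :: "nat \<Rightarrow> 'a::comm_monoid_add"
proof -
  have "(\<Sum>j=1..2*n. f j) = (\<Sum>j=1..n. f j) + (\<Sum>j=n+1..2*n. f j)"
    using sum.ub_add_nat[of 1 n f n] by (simp add: mult_2)
  also have "(\<Sum>j=n+1..2*n. f j) = (\<Sum>j=1..n. f (2 * n + 1 - j))"
    by (rule sum.reindex_bij_witness[of _ "\<lambda>j. 2 * n + 1 - j" "\<lambda>j. 2 * n + 1 - j"]) auto
  finally show ?thesis by (simp add: sum.distrib)
qed

text \<open>When \<open>p = 2 * n + 1\<close>, the odd numbers below \<open>p\<close> are the
  \<open>p - 2 * j\<close>, so odd reciprocals can be compared with even ones modulo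
  \<open>p\<close>.\<close>

lemma osum_reflect: "osum r n = (\<Sum>j=1..n. 1 / of_nat (2 * n + 1 - 2 * j) ^ r)"
  unfolding osum_def
  by (rule sum.reindex_bij_witness[of _ "\<lambda>j. n - j" "\<lambda>j. n - j"]) auto

lemma prod_one_plus_div:
  "(\<Prod>j=1..n. 1 + x / of_nat j) = pochhammer (1 + x) n / (fact n :: 'a::field_char_0)"
proof (induction n)
  case (Suc n)
  have "of_nat (Suc n) \<noteq> (0 :: 'a)" by (simp only: of_nat_eq_0_iff)
  then have "1 + x / of_nat (Suc n) = (1 + x + of_nat n) / of_nat (Suc n)"
    by (simp add: field_simps)
  then show ?case
    using Suc by (simp add: pochhammer_Suc fact_Suc mult_ac)
qed simp

text \<open>Meant for \<open>a = j\<close> and \<open>b = p - j\<close>, where \<open>a + b\<close>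
  is \<open>p\<close>; the exponent \<open>1\<close> matches the form of
  \<open>pcong 1\<close>.\<close>

lemma reciprocal_identities:
  fixes a b :: "'a::field"
  assumes "a \<noteq> 0" "b \<noteq> 0"
  shows "1 / a + 1 / b = (a + b) * (1 / a * (1 / b))"
    and "1 / a * (1 / b) - - (1 / a ^ 2) = (a + b) ^ 1 * (1 / a ^ 2 * (1 / b))"
    and "1 / b ^ 2 - 1 / a ^ 2 = (a + b) ^ 1 * ((a - b) * (1 / a ^ 2) * (1 / b ^ 2))"
  using assms by (simp_all add: divide_simps) (simp_all add: algebra_simps power2_eq_square)

locale prime_gt_3_half = prime_gt_3 +
  fixes N :: nat
  assumes p_eq: "p = 2 * N + 1"
begin

text \<open>The Fermat quotient of 2; its integrality is Fermat's little theorem.\<close>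

definition q :: rat where "q = (2 ^ (p - 1) - 1) / P"

lemma P_eq: "P = 2 * of_nat N + 1"
  by (subst p_eq) simp

lemma p_minus_1: "p - 1 = 2 * N"
  using p_eq by simp

lemma two_power: "2 ^ (2 * N) = 1 + P * q"
  by (simp add: q_def flip: p_minus_1)

lemma Zp_q [simp, intro]: "Zp q"
proof -
  have "\<not> p dvd 2" using gt3 by (auto dest: dvd_imp_le)
  then have "[2 ^ (p - 1) = 1] (mod p)"
    using fermat_theorem[OF prime] by blast
  then have "int p dvd 2 ^ (p - 1) - 1"
    by (metis cong_iff_dvd_diff cong_int_iff of_nat_1 of_nat_numeral of_nat_power)
  then obtain c where "2 ^ (p - 1) - 1 = int p * c" by (elim dvdE)
  then have "(of_int (2 ^ (p - 1) - 1) :: rat) = of_int (int p * c)" by simp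
  then have "q = of_int c" by (simp add: q_def)
  then show ?thesis by simp
qed

lemma Zp_inverse_power: "0 < j \<Longrightarrow> j < p \<Longrightarrow> Zp (1 / of_nat j ^ r)"
  using Zp_power[OF Zp_divide_less[of 1 j], of r] by (simp add: power_one_over)

lemma Zp_inverse: "0 < j \<Longrightarrow> j < p \<Longrightarrow> Zp (1 / of_nat j)"
  by (rule Zp_divide_less) simp_all

lemma Zp_hsum [intro]: "n < p \<Longrightarrow> Zp (hsum r n)"
  unfolding hsum_def by (intro Zp_sum Zp_inverse_power) auto

lemma Zp_osum [intro]: "n \<le> N \<Longrightarrow> Zp (osum r n)"
  unfolding osum_def by (intro Zp_sum Zp_inverse_power) (auto simp: p_eq)

lemma N_less: "N < p" "2 * N < p"
  using p_eq by simp_all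

lemma gt4: "p > 4"
  using p_eq gt3 by presburger

section \<open>Reflection \<open>j\<close> to \<open>p - j\<close> and the vanishing of power
  sums\<close>

lemma P_split: "j < p \<Longrightarrow> P = of_nat j + of_nat (p - j)"
  by (simp flip: of_nat_add)

lemma inverse_square_reflect:
  assumes "0 < j" "j < p"
  shows "pcong 1 (1 / of_nat (p - j) ^ 2) (1 / of_nat j ^ 2)"
proof (rule pcongI)
  let ?c = "(of_nat j - of_nat (p - j)) * (1 / of_nat j ^ 2) * (1 / of_nat (p - j) ^ 2)"
  show "Zp ?c" using assms
    by (intro Zp_mult Zp_diff Zp_inverse_power) auto
  have "of_nat j \<noteq> (0 :: rat)" "of_nat (p - j) \<noteq> (0 :: rat)"
    using assms by auto
  then show "1 / of_nat (p - j) ^ 2 - 1 / of_nat j ^ 2 = P ^ 1 * ?c"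
    unfolding P_split[OF assms(2)] by (rule reciprocal_identities)
qed

lemma hsum_2_reflect: "pcong 1 (hsum 2 (2 * N)) (2 * hsum 2 N)"
proof -
  have "hsum 2 (2 * N) = (\<Sum>j=1..N. 1 / of_nat j ^ 2 + 1 / of_nat (p - j) ^ 2)"
    unfolding hsum_def sum_reflect by (simp add: p_eq)
  also have "pcong 1 \<dots> (\<Sum>j=1..N. 1 / of_nat j ^ 2 + 1 / of_nat j ^ 2)"
    using N_less by (intro pcong_sum pcong_add inverse_square_reflect) auto
  also have "\<dots> = 2 * hsum 2 N"
    by (simp add: hsum_def sum_distrib_left)
  finally show ?thesis .
qed

text \<open>
  Reflection gives \<open>hsum 2 (2 * N) = 2 * hsum 2 N\<close>, while the parity splitting gives
  \<open>hsum 2 (2 * N) = hsum 2 N / 2\<close>, both modulo \<open>p\<close>; this is where \<open>p \<noteq> 3\<close> is needed.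
\<close>

lemma hsum_2_N: "pcong 1 (hsum 2 N) 0"
proof -
  have "pcong 1 (osum 2 N) (hsum 2 N / 2 ^ 2)"
  proof -
    have "osum 2 N = (\<Sum>j=1..N. 1 / of_nat (p - 2 * j) ^ 2)"
      unfolding osum_reflect by (simp add: p_eq)
    also have "pcong 1 \<dots> (\<Sum>j=1..N. 1 / of_nat (2 * j) ^ 2)"
      using N_less by (intro pcong_sum inverse_square_reflect) auto
    also have "\<dots> = hsum 2 N / 2 ^ 2"
      by (simp add: hsum_def sum_divide_distrib mult.commute)
    finally show ?thesis .
  qed
  then have "pcong 1 (hsum 2 (2 * N)) (hsum 2 N / 2 ^ 2 + hsum 2 N / 2 ^ 2)"
    unfolding hsum_double by (rule pcong_add) simp
  with pcong_sym[OF hsum_2_reflect]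
  have "pcong 1 (2 * hsum 2 N) (hsum 2 N / 2 ^ 2 + hsum 2 N / 2 ^ 2)"
    by (rule pcong_trans)
  \<comment> \<open>With \<open>h = hsum 2 N\<close>, doubling \<open>2 * h = h / 2\<close> and
    subtracting \<open>h\<close> leaves \<open>3 * h = 0\<close>.\<close>
  then have "pcong 1 (2 * (2 * hsum 2 N) - hsum 2 N) (2 * (hsum 2 N / 2 ^ 2 + hsum 2 N / 2 ^ 2) - hsum 2 N)"
    by (intro pcong_diff pcong_mult_left) simp_all
  then have "pcong 1 (of_nat 3 * hsum 2 N) (of_nat 3 * 0)"
    by simp
  then show ?thesis by (rule pcong_cancel_less[rotated 2]) (use gt3 in auto)
qed

lemma hsum_2_p: "pcong 1 (hsum 2 (2 * N)) 0"
  using pcong_trans[OF hsum_2_reflect pcong_mult_left[OF _ hsum_2_N, of 2]] by simp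

lemma osum_2_N: "pcong 1 (osum 2 N) 0"
proof -
  have "pcong 1 (hsum 2 (2 * N) - 1 / 2 ^ 2 * hsum 2 N) (0 - 1 / 2 ^ 2 * 0)"
    by (intro pcong_diff pcong_mult_left hsum_2_N hsum_2_p Zp_divide_power_2) simp
  then show ?thesis by (simp add: hsum_double)
qed

text \<open>Wolstenholme's theorem. Pairing \<open>j\<close> with \<open>p - j\<close> extracts one
  factor \<open>p\<close>; the remaining sum is \<open>- hsum 2 N\<close> modulo \<open>p\<close>,
  which vanishes there.\<close>

lemma hsum_1_p: "pcong 2 (hsum 1 (2 * N)) 0"
proof -
  have "pcong 1 (\<Sum>j=1..N. 1 / of_nat j * (1 / of_nat (p - j))) (\<Sum>j=1..N. - (1 / of_nat j ^ 2))"
  proof (rule pcong_sum)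
    fix j assume "j \<in> {1..N}"
    then have j: "0 < j" "j < p" using N_less by auto
    let ?c = "1 / of_nat j ^ 2 * (1 / of_nat (p - j))"
    have "of_nat j \<noteq> (0 :: rat)" "of_nat (p - j) \<noteq> (0 :: rat)"
      using j by auto
    then have "1 / of_nat j * (1 / of_nat (p - j)) - - (1 / of_nat j ^ 2) = P ^ 1 * ?c"
      unfolding P_split[OF j(2)] by (rule reciprocal_identities)
    moreover have "Zp ?c"
      using j by (intro Zp_mult Zp_inverse_power Zp_inverse) auto
    ultimately show "pcong 1 (1 / of_nat j * (1 / of_nat (p - j))) (- (1 / of_nat j ^ 2))"
      by (rule pcongI[rotated])
  qed
  also have "(\<Sum>j=1..N. - (1 / of_nat j ^ 2)) = - hsum 2 N"
    by (simp add: hsum_def sum_negf)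
  also have "pcong 1 \<dots> (- 0)"
    by (intro pcong_uminus hsum_2_N)
  finally have "pcong (1 + 1) (P ^ 1 * (\<Sum>j=1..N. 1 / of_nat j * (1 / of_nat (p - j)))) (P ^ 1 * - 0)"
    unfolding pcong_shift .
  moreover have "hsum 1 (2 * N) = P ^ 1 * (\<Sum>j=1..N. 1 / of_nat j * (1 / of_nat (p - j)))"
  proof -
    have "hsum 1 (2 * N) = (\<Sum>j=1..N. 1 / of_nat j + 1 / of_nat (p - j))"
      unfolding hsum_def sum_reflect by (simp add: p_eq)
    also have "\<dots> = (\<Sum>j=1..N. P * (1 / of_nat j * (1 / of_nat (p - j))))"
    proof (rule sum.cong)
      fix j assume "j \<in> {1..N}"
      then have j: "0 < j" "j < p" using N_less by auto
      then have "of_nat j \<noteq> (0 :: rat)" "of_nat (p - j) \<noteq> (0 :: rat)" by auto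
      then show "1 / of_nat j + 1 / of_nat (p - j) = P * (1 / of_nat j * (1 / of_nat (p - j)))"
        unfolding P_split[OF j(2)] by (rule reciprocal_identities)
    qed simp
    finally show ?thesis by (simp add: sum_distrib_left)
  qed
  ultimately show ?thesis by (simp add: numeral_2_eq_2)
qed

text \<open>Normalised so that Morley's congruence becomes \<open>central = 1\<close> modulo
  \<open>p ^ 3\<close>.\<close>

definition central :: rat where
  "central = (-1) ^ N * of_nat ((2 * N) choose N) / 4 ^ (2 * N)"

lemma fact_double_N: "fact (2 * N) = (fact N ^ 2 * of_nat ((2 * N) choose N) :: rat)"
  using binomial_fact[of N "2 * N", where 'a = rat] by (simp add: power2_eq_square field_simps mult_2)

lemma four_power: "4 ^ N = 1 + P * q" "4 ^ (2 * N) = (1 + P * q) ^ 2"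
proof -
  show *: "4 ^ N = 1 + P * q"
    unfolding two_power[symmetric] by (simp add: power_mult)
  show "4 ^ (2 * N) = (1 + P * q) ^ 2"
    unfolding *[symmetric] by (simp add: power_mult[symmetric] mult.commute)
qed

lemma pochhammer_half_N: "pochhammer (1/2) N = (fact N * of_nat ((2 * N) choose N) / 4 ^ N :: rat)"
proof -
  have "fact (2 * N) = (4 ^ N * pochhammer (1/2) N * fact N :: rat)"
    by (simp add: fact_double power_mult)
  then have "4 ^ N * pochhammer (1/2) N * fact N = (fact N * of_nat ((2 * N) choose N) * fact N :: rat)"
    unfolding fact_double_N by (simp add: power2_eq_square mult_ac)
  then show ?thesis by (simp add: field_simps)
qed

text \<open>Since \<open>1 - p = - 2 * N\<close>, the numerator is a rising factorial from
  \<open>- 2 * N\<close>, hence the central binomial coefficient up to sign and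
  \<open>fact N\<close>.\<close>

lemma prod_one_minus: "(\<Prod>j=1..N. 1 + P * (- 1 / of_nat j)) = central * (1 + P * q) ^ 2"
proof -
  have "(\<Prod>j=1..N. 1 + P * (- 1 / of_nat j)) = (\<Prod>j=1..N. 1 + - P / of_nat j)" by simp
  also have "\<dots> = pochhammer (1 + - P) N / fact N"
    by (rule prod_one_plus_div)
  also have "1 + - P = - of_nat (2 * N)"
    by (simp add: P_eq)
  also have "pochhammer (- of_nat (2 * N)) N / fact N = (-1) ^ N * ((of_nat (2 * N) :: rat) gchoose N)"
    by (simp add: gbinomial_pochhammer flip: power_mult_distrib)
  finally show ?thesis
    unfolding four_power(2)[symmetric] central_def by (simp add: binomial_gbinomial)
qed

text \<open>Here \<open>1 - p / 2 = - (N - 1 / 2)\<close>, and reversing the rising factorial turns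
  it into \<open>pochhammer (1 / 2) N\<close> up to sign.\<close>

lemma prod_one_minus_half: "(\<Prod>j=1..N. 1 + P * (- 1 / of_nat (2 * j))) = central * (1 + P * q)"
proof -
  have "(\<Prod>j=1..N. 1 + P * (- 1 / of_nat (2 * j))) = (\<Prod>j=1..N. 1 + (- P / 2) / of_nat j)" by simp
  also have "\<dots> = pochhammer (1 + - P / 2) N / fact N"
    by (rule prod_one_plus_div)
  also have "1 + - P / 2 = - (of_nat N - 1 / 2)"
    by (simp add: P_eq field_simps)
  also have "pochhammer (- (of_nat N - 1 / 2)) N = (-1) ^ N * pochhammer (1 / 2 :: rat) N"
    unfolding pochhammer_minus by simp
  also have "\<dots> / fact N = central * 4 ^ N"
    unfolding pochhammer_half_N central_def
    by (simp add: power_mult power2_eq_square field_simps flip: power_mult_distrib)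
  finally show ?thesis unfolding four_power .
qed

text \<open>For these two lengths the sum of inverse squares vanishes modulo \<open>p\<close>, so
  the second-order term is just the square of the first-order one.\<close>

lemma prod_one_plus_N:
  assumes "Zp b" "n = N \<or> n = 2 * N"
  shows "pcong 3 (2 * (\<Prod>j=1..n. 1 + P * (b / of_nat j)))
    (2 + 2 * P * (b * hsum 1 n) + P ^ 2 * (b * hsum 1 n) ^ 2)"
proof -
  have sm: "(\<Sum>j=1..n. b / of_nat j) = b * hsum 1 n" "(\<Sum>j=1..n. (b / of_nat j) ^ 2) = b ^ 2 * hsum 2 n"
    by (simp_all add: hsum_def sum_distrib_left power_divide)
  have "n < p" using assms(2) N_less by auto
  then have "pcong 3 (2 * (\<Prod>j=1..n. 1 + P * (b / of_nat j)))
    (2 + 2 * P * (b * hsum 1 n) + P ^ 2 * ((b * hsum 1 n) ^ 2 - b ^ 2 * hsum 2 n))"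
    using assms(1) unfolding sm[symmetric]
    by (intro prod_one_plus_pcong Zp_divide_less) auto
  moreover have "pcong 1 (hsum 2 n) 0"
    using assms(2) hsum_2_N hsum_2_p by auto
  then have "pcong (1 + 2) (P ^ 2 * ((b * hsum 1 n) ^ 2 - b ^ 2 * hsum 2 n)) (P ^ 2 * ((b * hsum 1 n) ^ 2 - b ^ 2 * 0))"
    unfolding pcong_shift using assms(1) by (intro pcong_diff pcong_mult_left) auto
  then have "pcong 3 (2 + 2 * P * (b * hsum 1 n) + P ^ 2 * ((b * hsum 1 n) ^ 2 - b ^ 2 * hsum 2 n))
     (2 + 2 * P * (b * hsum 1 n) + P ^ 2 * (b * hsum 1 n) ^ 2)"
    by (intro pcong_add) (auto simp: numeral_3_eq_3)
  ultimately show ?thesis by (rule pcong_trans)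
qed

lemma Zp_half: "Zp (1 / 2)" "Zp (- 1 / 2)"
  using Zp_divide_2[of 1] Zp_divide_2[of "-1"] Zp_of_int[of "-1"] by simp_all

text \<open>
  The products of \<open>1 - p / j\<close> and of \<open>1 - p / (2 * j)\<close> over \<open>j \<le> N\<close> differ by the exact
  factor \<open>2 ^ (p - 1)\<close>. Expanding both modulo \<open>p ^ 3\<close> determines \<open>hsum 1 N\<close>, and then also
  \<open>central\<close>.
\<close>

lemma hsum_1_N: "pcong 2 (hsum 1 N) (- 2 * q + P * q ^ 2)"
proof -
  define h where "h = hsum 1 N"
  have h: "Zp h" using N_less by (auto simp: h_def)
  have A: "pcong 3 (2 * (central * (1 + P * q) ^ 2)) (2 - 2 * P * h + P ^ 2 * h ^ 2)"
    using prod_one_plus_N[of "-1" N] Zp_of_int[of "-1"] unfolding prod_one_minus by (simp add: h_def)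
  have "pcong 3 (2 * (central * (1 + P * q))) (2 - P * h + P ^ 2 * (- 1 / 2 * h) ^ 2)"
    using prod_one_plus_N[of "-1/2" N] Zp_half(2) prod_one_minus_half by (simp add: h_def)
  \<comment> \<open>The multiplier makes the left side equal to four times that of \<open>A\<close>,
    which eliminates \<open>central\<close>.\<close>
  from pcong_mult_left[OF _ this, of "4 * (1 + P * q)"]
  have "pcong 3 (4 * (2 * (central * (1 + P * q) ^ 2))) ((1 + P * q) * (8 - 4 * P * h + P ^ 2 * h ^ 2))"
    by (simp add: power2_eq_square algebra_simps Zp_add Zp_mult)
  with pcong_mult_left[OF _ A, of 4]
  have "pcong 3 (4 * (2 - 2 * P * h + P ^ 2 * h ^ 2)) ((1 + P * q) * (8 - 4 * P * h + P ^ 2 * h ^ 2))"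
    using pcong_sym pcong_trans Zp_simple by blast
  from pcong_diff[OF this pcong_refl[of 3 "8 - 4 * P * h + P ^ 2 * h ^ 2"]]
  have "pcong (2 + 1) (P ^ 1 * (- 4 * h + 3 * P * h ^ 2)) (P ^ 1 * (q * (8 - 4 * P * h + P ^ 2 * h ^ 2)))"
    by (simp add: algebra_simps power2_eq_square numeral_3_eq_3)
  then have *: "pcong 2 (- 4 * h + 3 * P * h ^ 2) (q * (8 - 4 * P * h + P ^ 2 * h ^ 2))"
    unfolding pcong_shift .
  then obtain c where c: "Zp c" "- 4 * h + 3 * P * h ^ 2 = q * (8 - 4 * P * h + P ^ 2 * h ^ 2) + P ^ 2 * c"
    by (rule pcong_witness)
  \<comment> \<open>The relation is solved in two rounds: first modulo \<open>p\<close>, where the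
    nonlinear terms disappear, then modulo \<open>p ^ 2\<close> after substituting
    \<open>h = - 2 * q + P * z\<close> into them.\<close>
  have "pcong 1 (of_nat 4 * h) (of_nat 4 * (- 2 * q))"
  proof (rule pcongI)
    show "of_nat 4 * h - of_nat 4 * (- 2 * q) = P ^ 1 * (3 * h ^ 2 + 4 * q * h - P * h ^ 2 * q - P * c)"
      using c(2) by (simp add: algebra_simps power2_eq_square)
  qed (intro Zp_intros c h Zp_q)
  then have "pcong 1 h (- 2 * q)"
    by (rule pcong_cancel_less[rotated 2]) (use gt4 in auto)
  then obtain z where z: "Zp z" "h = - 2 * q + P * z"
    by (auto elim: pcong_witness)
  have "pcong 2 (of_nat 4 * h) (of_nat 4 * (- 2 * q + P * q ^ 2))"
  proof (rule pcongI)
    show "of_nat 4 * h - of_nat 4 * (- 2 * q + P * q ^ 2) =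
       P ^ 2 * (3 * (- 4 * q * z + P * z ^ 2) + 4 * q * z - q * h ^ 2 - c)"
      using c(2) unfolding z(2) by (simp add: algebra_simps power2_eq_square power3_eq_cube)
  qed (intro Zp_intros z c h Zp_q)
  then show ?thesis
    unfolding h_def by (rule pcong_cancel_less[rotated 2]) (use gt4 in auto)
qed

text \<open>Inserting \<open>hsum 1 N\<close> into the expansion of the product of
  \<open>1 - p / j\<close> gives \<open>(1 + P * q) ^ 2\<close>, which is \<open>4 ^ (p - 1)\<close>
  and can be cancelled.\<close>

lemma morley: "pcong 3 central 1"
proof -
  define h where "h = hsum 1 N"
  obtain z where z: "Zp z" "h = - 2 * q + P * q ^ 2 + P ^ 2 * z"
    using hsum_1_N unfolding h_def by (rule pcong_witness)
  have "pcong 3 (2 * (central * (1 + P * q) ^ 2)) (2 - 2 * P * h + P ^ 2 * h ^ 2)"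
    using prod_one_plus_N[of "-1" N] Zp_of_int[of "-1"] unfolding prod_one_minus by (simp add: h_def)
  also have "pcong 3 (2 - 2 * P * h + P ^ 2 * h ^ 2) (2 * (1 * (1 + P * q) ^ 2))"
  proof (rule pcongI)
    show "2 - 2 * P * h + P ^ 2 * h ^ 2 - 2 * (1 * (1 + P * q) ^ 2) =
      P ^ 3 * (- 2 * z + 2 * (- 2 * q) * (q ^ 2 + P * z) + P * (q ^ 2 + P * z) ^ 2)"
      unfolding z(2) by (simp add: algebra_simps power2_eq_square power3_eq_cube)
  qed (intro Zp_intros z Zp_q)
  finally have "pcong 3 (of_nat (2 * 4 ^ (2 * N)) * central) (of_nat (2 * 4 ^ (2 * N)) * 1)"
    unfolding four_power(2)[symmetric] by (simp add: mult_ac)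
  moreover have "\<not> p dvd 2 * 4 ^ (2 * N)"
  proof
    assume "p dvd 2 * 4 ^ (2 * N)"
    then have "p dvd 2 \<or> p dvd 4"
      using prime by (auto simp: prime_dvd_mult_iff dest: prime_dvd_power)
    then show False using gt4 by (auto dest: dvd_imp_le)
  qed
  ultimately show ?thesis by (rule pcong_cancel[rotated])
qed

lemma Zp_central: "Zp central"
  using Zp_of_pcong[OF morley] by simp

text \<open>Parity splitting of \<open>hsum 1 (2 * N)\<close>, which is zero modulo
  \<open>p ^ 2\<close>; doubled to avoid halves.\<close>

lemma osum_1_N: "pcong 2 (2 * osum 1 N) (2 * q - P * q ^ 2)"
proof -
  have "2 * osum 1 N = 2 * hsum 1 (2 * N) - hsum 1 N"
    using hsum_double[of 1 N] by simp
  also have "pcong 2 \<dots> (2 * 0 - (- 2 * q + P * q ^ 2))"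
    by (intro pcong_diff pcong_mult_left hsum_1_p hsum_1_N Zp_simple)
  finally show ?thesis by (simp add: algebra_simps)
qed

text \<open>Euler's criterion gives the congruence; both sides are so small that it forces
  equality.\<close>

lemma Legendre_minus_1: "Legendre (- 1) (int p) = (-1) ^ N"
proof -
  have "[Legendre (- 1) (int p) = (-1) ^ N] (mod int p)"
    using euler_criterion[of p "-1"] prime gt3 by (simp add: p_minus_1[simplified])
  moreover have "Legendre (- 1) (int p) \<in> {-1, 0, 1}"
    by (simp add: Legendre_def)
  moreover have "(-1 :: int) ^ N \<in> {-1, 1}"
    by (cases "even N") auto
  ultimately have "int p dvd Legendre (- 1) (int p) - (-1) ^ N"
     "\<bar>Legendre (- 1) (int p) - (-1) ^ N\<bar> < int p"
    using gt3 by (auto simp: cong_iff_dvd_diff)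
  then show ?thesis
    by (metis dvd_imp_le_int eq_iff_diff_eq_0 abs_of_nat not_le)
qed

section \<open>The boundary terms\<close>

definition boundary_ratio :: "nat \<Rightarrow> rat" where
  "boundary_ratio k = pochhammer (1/2 + P) k * pochhammer (- 1/2 - P/2) k / pochhammer (1/2) k ^ 2"

text \<open>With \<open>P\<close> replaced by \<open>0\<close>, \<open>boundary_ratio k\<close>
  would be \<open>- 1 / (2 * k - 1)\<close>. Scaling by \<open>2 * k - 1\<close> thus leaves a
  recurrence whose factors are all \<open>1\<close> plus a multiple of \<open>P\<close>.\<close>

lemma boundary_ratio_Suc: "(2 * of_nat k + 1) * boundary_ratio (Suc k) = (2 * of_nat k - 1) * boundary_ratio k *
    ((1 + 2 * P * (1 / (2 * of_nat k + 1))) * (1 - P * (1 / (2 * of_nat k - 1))))"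
proof -
  define x :: rat where "x = of_nat k"
  define h where "h = pochhammer (1/2 :: rat) k"
  have nz: "h \<noteq> 0" "2 * x + 1 \<noteq> 0" "2 * x - 1 \<noteq> 0"
  proof -
    show "h \<noteq> 0" using pochhammer_half_pos[of k] by (simp add: h_def)
    have "x \<ge> 0" by (simp add: x_def)
    then show "2 * x + 1 \<noteq> 0" by linarith
    have "of_int (2 * int k - 1) \<noteq> (0 :: rat)" by (simp only: of_int_eq_0_iff) presburger
    then show "2 * x - 1 \<noteq> 0" by (simp add: x_def)
  qed
  have "boundary_ratio (Suc k) = boundary_ratio k * ((1/2 + P + x) * (- 1/2 - P/2 + x) / (1/2 + x) ^ 2)"
    by (simp add: boundary_ratio_def x_def pochhammer_Suc power_mult_distrib)
  also have "(1/2 + P + x) * (- 1/2 - P/2 + x) / (1/2 + x) ^ 2 =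
      (2 * x + 1 + 2 * P) * (2 * x - 1 - P) / (2 * x + 1) ^ 2"
  proof -
    have "1/2 + x = (2 * x + 1) / 2" "1/2 + P + x = (2 * x + 1 + 2 * P) / 2"
      "- 1/2 - P/2 + x = (2 * x - 1 - P) / 2"
      by (simp_all add: field_simps)
    show ?thesis
      unfolding \<open>1/2 + x = _\<close> \<open>1/2 + P + x = _\<close> \<open>- 1/2 - P/2 + x = _\<close> by (simp add: power_divide)
  qed
  finally have "(2 * x + 1) * boundary_ratio (Suc k) =
      boundary_ratio k * ((2 * x + 1) / (2 * x + 1) * ((2 * x + 1 + 2 * P) / (2 * x + 1)) * (2 * x - 1 - P))"
    by (simp add: power2_eq_square mult_ac)
  also have "\<dots> = (2 * x - 1) * boundary_ratio k * ((2 * x + 1 + 2 * P) / (2 * x + 1) * ((2 * x - 1 - P) / (2 * x - 1)))"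
    using nz by simp
  also have "(2 * x + 1 + 2 * P) / (2 * x + 1) = 1 + 2 * P * (1 / (2 * x + 1))"
    using nz by (simp add: add_divide_distrib)
  also have "(2 * x - 1 - P) / (2 * x - 1) = 1 - P * (1 / (2 * x - 1))"
    using nz by (simp add: diff_divide_distrib)
  finally show ?thesis by (simp add: x_def)
qed

lemma Zp_inverse_odd:
  assumes "k < N" shows "Zp (1 / (2 * of_nat k + 1))"
  using Zp_inverse[of "2 * k + 1"] assms p_eq by (simp add: add.commute)

lemma Zp_inverse_odd':
  assumes "k < N" shows "Zp (1 / (2 * of_nat k - 1))"
proof (cases k)
  case 0
  then show ?thesis using Zp_of_int[of "-1"] by simp
next
  case (Suc m)
  then show ?thesis using assms Zp_inverse_odd[of m] by (simp add: add.commute)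
qed

lemma osum_Suc: "osum 1 (Suc k) = osum 1 k + 1 / (2 * of_nat k + 1)"
  by (simp add: osum_def add.commute)

text \<open>To first order the recurrence adds up \<open>2 / (2 * j + 1) - 1 / (2 * j - 1)\<close>
  for \<open>j < k\<close>. The second part is a shifted odd harmonic sum; its term
  \<open>j = 0\<close> contributes the constant \<open>1\<close>, and the shift contributes
  \<open>1 / (2 * k - 1)\<close>.\<close>

lemma boundary_ratio_pcong:
  "k \<le> N \<Longrightarrow> pcong 2 ((2 * of_nat k - 1) * boundary_ratio k)
    (- (1 + P * (1 + osum 1 k + 1 / (2 * of_nat k - 1))))"
proof (induction k)
  case 0
  show ?case by (simp add: boundary_ratio_def osum_def)
next
  case (Suc k)
  define r where "r = 1 / (2 * of_nat k - 1 :: rat)"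
  define s where "s = 1 / (2 * of_nat k + 1 :: rat)"
  define A where "A = 1 + osum 1 k + r"
  have z: "Zp r" "Zp s"
    using Zp_inverse_odd Zp_inverse_odd' Suc.prems by (auto simp: r_def s_def)
  have zA: "Zp A"
    unfolding A_def by (intro Zp_intros Zp_osum z) (use Suc.prems in simp)
  obtain c where c: "Zp c" "(2 * of_nat k - 1) * boundary_ratio k = - (1 + P * A) + P ^ 2 * c"
    using Suc by (auto simp: A_def r_def elim: pcong_witness)
  have "(2 * of_nat (Suc k) - 1) * boundary_ratio (Suc k) = (- (1 + P * A) + P ^ 2 * c) * ((1 + 2 * P * s) * (1 - P * r))"
    using boundary_ratio_Suc[of k] unfolding c(2) by (simp add: r_def s_def add.commute)
  moreover have "1 + osum 1 (Suc k) + 1 / (2 * of_nat (Suc k) - 1) = A - r + 2 * s"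
    unfolding osum_Suc by (simp add: A_def s_def add.commute)
  moreover have "pcong 2 ((- (1 + P * A) + P ^ 2 * c) * ((1 + 2 * P * s) * (1 - P * r)))
      (- (1 + P * (A - r + 2 * s)))"
  proof (rule pcongI)
    show "(- (1 + P * A) + P ^ 2 * c) * ((1 + 2 * P * s) * (1 - P * r)) - - (1 + P * (A - r + 2 * s)) =
      P ^ 2 * (c * ((1 + 2 * P * s) * (1 - P * r)) + 2 * r * s * (1 + P * A) - A * (2 * s - r))"
      by (simp add: algebra_simps power2_eq_square)
  qed (intro Zp_intros z zA c)
  ultimately show ?case by (simp only:)
qed

text \<open>With \<open>T = osum 1 N\<close> and \<open>osum 2 N\<close> zero modulo
  \<open>p\<close>, the sum is \<open>- (1 + P) * T - P * T ^ 2 / 2\<close>. Inserting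
  \<open>T = q - P * q ^ 2 / 2\<close>, the two terms in \<open>P * q ^ 2\<close> cancel.\<close>

lemma sum_boundary_ratio: "pcong 2 (\<Sum>k<N. boundary_ratio (Suc k)) (- (1 + P) * q)"
proof -
  define S where "S = (\<Sum>k<N. osum 1 (Suc k) * (1 / of_nat (2 * k + 1)))"
  define T where "T = osum 1 N"
  have S: "2 * S = T ^ 2 + osum 2 N"
    using sum_osum_div[of N] by (simp add: S_def T_def)
  have zT: "Zp T" by (auto simp: T_def)
  obtain y where y: "Zp y" "osum 2 N = P * y"
    using osum_2_N by (auto elim: pcong_witness)
  obtain x where x: "Zp x" "2 * T = 2 * q - P * q ^ 2 + P ^ 2 * x"
    using osum_1_N by (auto simp: T_def elim: pcong_witness)
  have "pcong 2 (\<Sum>k<N. boundary_ratio (Suc k))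
      (\<Sum>k<N. 1 / of_nat (2 * k + 1) * - (1 + P * (1 + osum 1 (Suc k) + 1 / of_nat (2 * k + 1))))"
  proof (rule pcong_sum)
    fix k assume "k \<in> {..<N}"
    then have k: "k < N" by simp
    have "of_nat (2 * k + 1) \<noteq> (0 :: rat)" by (simp only: of_nat_eq_0_iff)
    then have eq: "1 / of_nat (2 * k + 1) * (of_nat (2 * k + 1) * boundary_ratio (Suc k)) = boundary_ratio (Suc k)"
      by simp
    have "pcong 2 (of_nat (2 * k + 1) * boundary_ratio (Suc k))
        (- (1 + P * (1 + osum 1 (Suc k) + 1 / of_nat (2 * k + 1))))"
      using boundary_ratio_pcong[of "Suc k"] k by (simp add: add.commute add.left_commute)
    then show "pcong 2 (boundary_ratio (Suc k)) (1 / of_nat (2 * k + 1) *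
        - (1 + P * (1 + osum 1 (Suc k) + 1 / of_nat (2 * k + 1))))"
      by (subst eq[symmetric], intro pcong_mult_left Zp_inverse) (use k p_eq in auto)
  qed
  also have "(\<Sum>k<N. 1 / of_nat (2 * k + 1) * - (1 + P * (1 + osum 1 (Suc k) + 1 / of_nat (2 * k + 1))))
     = - (1 + P) * T - P * S - P * osum 2 N"
  proof -
    have "(\<Sum>k<N. 1 / of_nat (2 * k + 1) * - (1 + P * (1 + osum 1 (Suc k) + 1 / of_nat (2 * k + 1))))
      = (\<Sum>k<N. - (1 + P) * (1 / of_nat (2 * k + 1) ^ 1) - P * (osum 1 (Suc k) * (1 / of_nat (2 * k + 1)))
        - P * (1 / of_nat (2 * k + 1) ^ 2))"
      by (rule sum.cong[OF refl])
        (simp add: algebra_simps power2_eq_square add_divide_distrib diff_divide_distrib)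
    then show ?thesis
      unfolding S_def T_def osum_def[of _ N] sum_subtractf sum_distrib_left by simp
  qed
  finally have "pcong 2 (2 * (\<Sum>k<N. boundary_ratio (Suc k))) (2 * (- (1 + P) * T - P * S - P * osum 2 N))"
    by (intro pcong_mult_left) auto
  also have "2 * (- (1 + P) * T - P * S - P * osum 2 N) =
      - (1 + P) * (2 * T) - P * (2 * S) - 2 * P * osum 2 N"
    by (simp add: algebra_simps)
  also have "\<dots> = - (1 + P) * (2 * T) - P * (T ^ 2) - 3 * P * osum 2 N"
    unfolding S by (simp add: algebra_simps)
  also have "pcong 2 \<dots> (2 * (- (1 + P) * q))"
  proof -
    define v where "v = - (q ^ 2) + P * x"
    have v: "2 * T = 2 * q + P * v" using x(2) by (simp add: v_def algebra_simps power2_eq_square)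
    \<comment> \<open>The factor 4 turns \<open>T ^ 2\<close> into \<open>(2 * T) ^ 2\<close>, so
      the known value of \<open>2 * T\<close> can be substituted.\<close>
    have "pcong 2 (4 * (- (1 + P) * (2 * T) - P * (T ^ 2) - 3 * P * osum 2 N)) (4 * (2 * (- (1 + P) * q)))"
    proof (rule pcongI)
      have "4 * (- (1 + P) * (2 * T) - P * (T ^ 2) - 3 * P * osum 2 N) =
         - 4 * (1 + P) * (2 * T) - P * (2 * T) ^ 2 - 12 * P * osum 2 N"
        by (simp add: algebra_simps power2_eq_square)
      also have "\<dots> = - 4 * (1 + P) * (2 * q + P * v) - P * (2 * q + P * v) ^ 2 - 12 * P * (P * y)"
        unfolding v y(2) ..
      finally show "4 * (- (1 + P) * (2 * T) - P * (T ^ 2) - 3 * P * osum 2 N) - 4 * (2 * (- (1 + P) * q)) =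
          P ^ 2 * (- 4 * x - 4 * v - 4 * q * v - P * v ^ 2 - 12 * y)"
        by (simp add: v_def algebra_simps power2_eq_square)
    qed (unfold v_def, intro Zp_intros Zp_q x y)
    then have "pcong 2 (of_nat 4 * (- (1 + P) * (2 * T) - P * (T ^ 2) - 3 * P * osum 2 N))
        (of_nat 4 * (2 * (- (1 + P) * q)))"
      by simp
    then show ?thesis
      by (rule pcong_cancel_less[rotated 2]) (use gt4 in auto)
  qed
  finally have "pcong 2 (of_nat 2 * (\<Sum>k<N. boundary_ratio (Suc k))) (of_nat 2 * (- (1 + P) * q))"
    by simp
  then show ?thesis
    by (rule pcong_cancel_less[rotated 2]) (use gt4 in auto)
qed

section \<open>Products of \<open>1 + p / (2 * j)\<close> over \<open>j \<le> N\<close> and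
  \<open>j \<le> 2 * N\<close>\<close>

definition half_product :: rat where "half_product = pochhammer (1 + P / 2) N / fact N"
definition full_product :: rat where "full_product = pochhammer (1 + P / 2) (2 * N) / fact (2 * N)"

lemma half_product_pcong: "pcong 2 half_product (1 - P * q)"
proof -
  define h where "h = hsum 1 N"
  have zh: "Zp h" using N_less by (auto simp: h_def)
  obtain x where x: "Zp x" "h = - 2 * q + P * q ^ 2 + P ^ 2 * x"
    using hsum_1_N by (auto simp: h_def elim: pcong_witness)
  have "pcong 3 (2 * half_product) (2 + 2 * P * (1 / 2 * h) + P ^ 2 * (1 / 2 * h) ^ 2)"
    using prod_one_plus_N[of "1/2" N] prod_one_plus_div[of "P / 2" N] Zp_half
    by (simp add: half_product_def h_def)
  then have "pcong 2 (2 * half_product) (2 + 2 * P * (1 / 2 * h) + P ^ 2 * (1 / 2 * h) ^ 2)"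
    by (rule pcong_weaken) simp
  also have "pcong 2 \<dots> (2 * (1 - P * q))"
  proof (rule pcongI)
    have "2 + 2 * P * (1 / 2 * h) + P ^ 2 * (1 / 2 * h) ^ 2 = 2 + P * h + P ^ 2 * (1 / 2 * h) ^ 2"
      by simp
    also have "P * h = P * (- 2 * q + P * q ^ 2 + P ^ 2 * x)"
      unfolding x(2) ..
    finally show "2 + 2 * P * (1 / 2 * h) + P ^ 2 * (1 / 2 * h) ^ 2 - 2 * (1 - P * q)
        = P ^ 2 * (q ^ 2 + P * x + (1 / 2 * h) ^ 2)"
      by (simp add: algebra_simps power2_eq_square)
  qed (intro Zp_intros Zp_half Zp_q x zh)
  finally have "pcong 2 (of_nat 2 * half_product) (of_nat 2 * (1 - P * q))" by simp
  then show ?thesis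
    by (rule pcong_cancel_less[rotated 2]) (use gt4 in auto)
qed

text \<open>The linear term is a multiple of \<open>P * hsum 1 (2 * N)\<close>, which
  \<open>hsum_1_p\<close> makes divisible by \<open>p ^ 3\<close>.\<close>

lemma full_product_pcong: "pcong 3 full_product 1"
proof -
  define h where "h = hsum 1 (2 * N)"
  obtain x where x: "Zp x" "h = P ^ 2 * x"
    using hsum_1_p by (auto simp: h_def elim: pcong_witness)
  have "pcong 3 (2 * full_product) (2 + 2 * P * (1 / 2 * h) + P ^ 2 * (1 / 2 * h) ^ 2)"
    using prod_one_plus_N[of "1/2" "2 * N"] prod_one_plus_div[of "P / 2" "2 * N"] Zp_half
    by (simp add: full_product_def h_def)
  also have "pcong 3 \<dots> (2 * 1)"
  proof (rule pcongI)
    show "2 + 2 * P * (1 / 2 * h) + P ^ 2 * (1 / 2 * h) ^ 2 - 2 * 1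
        = P ^ 3 * (x + P ^ 3 * (1 / 2 * x) ^ 2)"
      unfolding x(2) by (simp add: algebra_simps power2_eq_square power3_eq_cube)
  qed (intro Zp_intros Zp_half x)
  finally have "pcong 3 (of_nat 2 * full_product) (of_nat 2 * 1)" by simp
  then show ?thesis
    by (rule pcong_cancel_less[rotated 2]) (use gt4 in auto)
qed

section \<open>Closed forms at \<open>N\<close> and the final assembly\<close>

lemma central_power2: "central ^ 2 = of_nat ((2 * N) choose N) ^ 2 / (4 ^ N) ^ 4"
  by (simp add: central_def power_divide power_mult_distrib flip: power_mult)

lemma sixteen_power: "(16 :: rat) ^ N = (4 ^ N) ^ 2"
proof -
  have "(16 :: rat) ^ N = (4 * 4) ^ N" by simp
  then show ?thesis by (simp only: power_mult_distrib power2_eq_square)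
qed

text \<open>Since \<open>1/2 + N = P / 2\<close>, the factor \<open>pochhammer (1/2) (3 * N)\<close>
  splits off \<open>pochhammer (P / 2) (2 * N)\<close>. Shifting its argument by one yields
  \<open>P\<close> over \<open>m = 6 * N + 1\<close>, and \<open>m\<close> cancels against the
  linear factor \<open>18 * N + 3 = 3 * m\<close>.\<close>

lemma wz_F_N: "wz_F N N = 3 * P * ((-1) ^ N * central * full_product)"
proof -
  define c :: rat where "c = of_nat ((2 * N) choose N)"
  define f :: rat where "f = fact N"
  define F :: rat where "F = 4 ^ N"
  define h where "h = pochhammer (1/2 :: rat) N"
  define m :: rat where "m = 6 * of_nat N + 1"
  define e where "e = pochhammer (1 + P / 2) (2 * N)"
  have nz: "f \<noteq> 0" "F \<noteq> 0" "c \<noteq> 0" "h \<noteq> 0" "m \<noteq> 0"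
    using pochhammer_half_pos[of N]
    by (auto simp: f_def F_def c_def h_def m_def add_eq_0_iff_both_eq_0)
  have E_eq: "full_product = e / (f ^ 2 * c)"
    by (simp add: full_product_def e_def f_def c_def fact_double_N)
  have half: "1/2 + of_nat N = P / 2"
    by (simp add: P_eq field_simps)
  have "pochhammer (P / 2) (Suc (2 * N)) = P / 2 * pochhammer (P / 2 + 1) (2 * N)"
    by (rule pochhammer_rec)
  moreover have "pochhammer (P / 2) (Suc (2 * N)) = pochhammer (P / 2) (2 * N) * (P / 2 + of_nat (2 * N))"
    by (rule pochhammer_Suc)
  ultimately have "pochhammer (P / 2) (2 * N) * (P / 2 + of_nat (2 * N)) = P / 2 * e"
    by (simp add: e_def add.commute)
  then have e: "m * pochhammer (P / 2) (2 * N) = P * e"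
    by (simp add: P_eq m_def field_simps)
  have "pochhammer (1/2) (2 * N + N) = h * pochhammer (P / 2) (2 * N)"
    using pochhammer_product'[of "1/2 :: rat" N "2 * N"] unfolding half
    by (simp add: h_def add.commute)
  then have "wz_F N N = 3 * m / F ^ 2 * h * (h * pochhammer (P / 2) (2 * N)) * f / (f ^ 3 * h ^ 2)"
    by (simp add: m_def wz_F_def sixteen_power F_def f_def h_def mult_2[symmetric])
  also have "\<dots> = 3 * (m * pochhammer (P / 2) (2 * N)) / (F ^ 2 * f ^ 2)"
    using nz by (simp add: power2_eq_square power3_eq_cube mult_ac)
  also have "\<dots> = 3 * P * (c / F ^ 2 * (e / (f ^ 2 * c)))"
    unfolding e using nz by simp
  also have "c / F ^ 2 = (-1) ^ N * central"
    by (simp add: central_def c_def F_def flip: power_mult power_mult_distrib)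
  finally show ?thesis unfolding E_eq by (simp add: mult_ac)
qed

text \<open>Both \<open>pochhammer (1/2) (Suc N)\<close> and
  \<open>pochhammer (1/2) (2 * Suc N + k)\<close> contain the factor \<open>1/2 + N = P / 2\<close>,
  whence \<open>P ^ 2\<close>. The binomial part is, up to sign, a rising factorial from
  \<open>- (N + 1) = - 1/2 - P/2\<close>. The multiplier \<open>1 + P = 2 * (N + 1)\<close> clears
  the denominator left by \<open>fact (Suc N) ^ 3\<close>.\<close>

lemma wz_G_N:
  "(1 + P) * wz_G (Suc N) k = P ^ 2 * (- ((-1) ^ N) * central ^ 2 * half_product * boundary_ratio (Suc k))"
proof -
  define c :: rat where "c = of_nat ((2 * N) choose N)"
  define f :: rat where "f = fact N"
  define F :: rat where "F = 4 ^ N"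
  define s :: rat where "s = (-1) ^ N"
  define d where "d = pochhammer (1 + P / 2) N"
  define a where "a = pochhammer (1 / 2 + P) (Suc k)"
  define b where "b = pochhammer (- 1 / 2 - P / 2) (Suc k)"
  define h where "h = pochhammer (1/2 :: rat) (Suc k)"
  define u where "u = 1 + P"
  have N1: "of_nat (Suc N) = u / 2"
    by (simp add: u_def P_eq field_simps)
  have nz: "f \<noteq> 0" "F \<noteq> 0" "h \<noteq> 0" "u \<noteq> 0"
    using pochhammer_half_pos[of "Suc k"]
    by (auto simp: f_def F_def h_def u_def add_eq_0_iff_both_eq_0)
  have h1: "pochhammer (1/2) (Suc N) = f * c / F * (P / 2)"
    unfolding pochhammer_Suc pochhammer_half_N by (simp add: f_def c_def F_def P_eq field_simps)
  have "pochhammer (1/2) p = pochhammer (1/2 :: rat) (Suc N) * pochhammer (1/2 + of_nat (Suc N)) N"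
    using pochhammer_product'[of "1/2 :: rat" "Suc N" N] p_eq by (simp add: mult_2)
  also have "1/2 + of_nat (Suc N) = 1 + P / 2"
    unfolding N1 u_def by (simp add: field_simps)
  finally have h2: "pochhammer (1/2) p = f * c / F * (P / 2) * d"
    unfolding h1 d_def .
  have "2 * Suc N + k = p + Suc k"
    using p_eq by simp
  then have h3: "pochhammer (1/2) (2 * Suc N + k) = f * c / F * (P / 2) * d * a"
    using pochhammer_product'[of "1/2 :: rat" p "Suc k"] unfolding h2 a_def by simp
  have "(-1) ^ Suc k * (of_nat (Suc N choose Suc k) * fact (Suc k) :: rat) = b"
    unfolding binomial_gbinomial gbinomial_pochhammer N1 b_def u_def
    by (simp add: power_mult_distrib[symmetric] diff_divide_distrib add_divide_distrib del: fact_Suc)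
  moreover have "(-1) ^ (Suc N + k + 1) = - s * (-1 :: rat) ^ Suc k"
    by (simp add: s_def power_add)
  ultimately have h4: "(-1) ^ (Suc N + k + 1) * (of_nat (Suc N choose Suc k) * fact (Suc k) :: rat) = - s * b"
    by (simp only: mult.assoc)
  have f1: "fact (Suc N) = u / 2 * f"
    by (simp only: fact_Suc N1 f_def)
  have p16: "16 ^ Suc N = 16 * F ^ 2"
    by (simp add: F_def sixteen_power)
  have "wz_G (Suc N) k = 32 * (((-1) ^ (Suc N + k + 1)) * (of_nat (Suc N choose Suc k) * fact (Suc k))) / 16 ^ Suc N
     * pochhammer (1/2) (Suc N) * pochhammer (1/2) (2 * Suc N + k) * of_nat (Suc N) ^ 2
     / (fact (Suc N) ^ 3 * pochhammer (1/2) (Suc k) ^ 2)"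
    by (simp add: wz_G_def mult_ac del: binomial_Suc_Suc fact_Suc of_nat_Suc pochhammer_Suc)
  also have "\<dots> = 32 * (- s * b) / (16 * F ^ 2) * (f * c / F * (P / 2)) * (f * c / F * (P / 2) * d * a) *
      (u / 2) ^ 2 / ((u / 2 * f) ^ 3 * h ^ 2)"
    by (simp only: h4 h1 h3 N1 f1 p16 h_def)
  also have "u * \<dots> = P ^ 2 * (- s * (c ^ 2 / F ^ 4) * (d / f) * (a * b / h ^ 2))"
    using nz by (simp add: field_simps eval_nat_numeral)
  finally show ?thesis
    unfolding u_def central_power2 half_product_def boundary_ratio_def s_def c_def F_def d_def f_def a_def b_def h_def .
qed

text \<open>The factor \<open>1 + P\<close> from \<open>sum_boundary_ratio\<close> matches the one
  in \<open>wz_G_N\<close>; it is prime to \<open>p\<close> and cancels.\<close>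

lemma sum_wz_G: "pcong 2 ((\<Sum>k<N. wz_G (Suc N) k) / P ^ 2) ((-1) ^ N * (q - P * q ^ 2))"
proof -
  define W where "W = (\<Sum>k<N. boundary_ratio (Suc k))"
  have W: "Zp W" "Zp half_product"
    using Zp_of_pcong[OF sum_boundary_ratio] Zp_of_pcong[OF half_product_pcong] by (auto simp: W_def)
  have s: "Zp (- ((-1) ^ N))"
    by (intro Zp_intros)
  have "(1 + P) * (\<Sum>k<N. wz_G (Suc N) k) = P ^ 2 * (- ((-1) ^ N) * central ^ 2 * half_product * W)"
    by (simp add: W_def sum_distrib_left wz_G_N del: sum.lessThan_Suc)
  then have "(1 + P) * ((\<Sum>k<N. wz_G (Suc N) k) / P ^ 2) = - ((-1) ^ N) * (central ^ 2 * half_product * W)"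
    by (simp add: field_simps)
  also have "pcong 2 \<dots> (- ((-1) ^ N) * (1 ^ 2 * (1 - P * q) * (- (1 + P) * q)))"
    unfolding W_def using W s Zp_central
    by (intro pcong_mult_left pcong_mult pcong_power sum_boundary_ratio half_product_pcong pcong_weaken[OF morley])
      (auto simp: W_def)
  also have "\<dots> = (1 + P) * ((-1) ^ N * (q - P * q ^ 2))"
    by (simp add: algebra_simps power2_eq_square)
  finally have "pcong 2 (of_nat (p + 1) * ((\<Sum>k<N. wz_G (Suc N) k) / P ^ 2))
      (of_nat (p + 1) * ((-1) ^ N * (q - P * q ^ 2)))"
    by (simp add: add.commute)
  then show ?thesis
  proof (rule pcong_cancel[rotated])
    show "\<not> p dvd p + 1" using gt3 dvd_add_right_iff[of p p 1] by simp
  qed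
qed

text \<open>The diagonal term carries \<open>P\<close> and the boundary sum \<open>P ^ 2\<close>, so
  precision \<open>p ^ 3\<close> and \<open>p ^ 2\<close> for their cofactors suffices modulo
  \<open>p ^ 4\<close>.\<close>

lemma sum_wz_F_N: "pcong 4 (\<Sum>n\<le>N. wz_F n 0) (P * (-1) ^ N * (3 + P * q - (P * q) ^ 2))"
proof -
  have s: "Zp ((-1) ^ N)"
    by (intro Zp_intros)
  define S where "S = (\<Sum>k<N. wz_G (Suc N) k) / P ^ 2"
  have "(\<Sum>n\<le>N. wz_F n 0) = P ^ 1 * (3 * ((-1) ^ N * central * full_product)) + P ^ 2 * S"
    unfolding sum_wz_F[of N N] sum_wz_F_diag wz_F_N S_def by simp
  also have "pcong 4 \<dots> (P ^ 1 * (3 * ((-1) ^ N * 1 * 1)) + P ^ 2 * ((-1) ^ N * (q - P * q ^ 2)))"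
  proof (rule pcong_add)
    have "pcong (3 + 1) (P ^ 1 * (3 * ((-1) ^ N * central * full_product))) (P ^ 1 * (3 * ((-1) ^ N * 1 * 1)))"
      unfolding pcong_shift using s Zp_of_pcong[OF full_product_pcong]
      by (intro pcong_mult_left pcong_mult morley full_product_pcong) auto
    then show "pcong 4 (P ^ 1 * (3 * ((-1) ^ N * central * full_product))) (P ^ 1 * (3 * ((-1) ^ N * 1 * 1)))"
      by simp
    have "pcong (2 + 2) (P ^ 2 * S) (P ^ 2 * ((-1) ^ N * (q - P * q ^ 2)))"
      unfolding pcong_shift S_def by (rule sum_wz_G)
    then show "pcong 4 (P ^ 2 * S) (P ^ 2 * ((-1) ^ N * (q - P * q ^ 2)))"
      by simp
  qed
  finally show ?thesis
    by (simp add: algebra_simps power2_eq_square)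
qed

end

theorem theorem1p2:
  fixes p :: nat
  assumes "prime p" and "p > 3"
  shows "rat_cong p 4
    (\<Sum>k = 0..(p - 1) div 2. (20 * of_nat k + 3) / (- (2 ^ 10)) ^ k * multinomial4 k)
    (of_nat p * of_int (Legendre (- 1) (int p)) *
      (2 ^ (p - 1) + 2 - (2 ^ (p - 1) - 1) ^ 2))"
proof -
  define N where "N = (p - 1) div 2"
  interpret prime_gt_3_half p N
    using assms prime_odd_nat[of p] by unfold_locales (auto simp: N_def)
  \<comment> \<open>In terms of \<open>q\<close>, the last factor on the right is
    \<open>3 + P * q - (P * q) ^ 2\<close>.\<close>
  have "(2 ^ (p - 1) :: rat) = 1 + P * q"
    by (simp only: p_minus_1 two_power)
  then have "P * of_int (Legendre (- 1) (int p)) * (2 ^ (p - 1) + 2 - (2 ^ (p - 1) - 1) ^ 2) =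
      P * (-1) ^ N * (3 + P * q - (P * q) ^ 2)"
    by (simp add: Legendre_minus_1 add.commute)
  moreover have "(\<Sum>k = 0..N. (20 * of_nat k + 3) / (- (2 ^ 10)) ^ k * multinomial4 k)
      = (\<Sum>n\<le>N. wz_F n 0)"
    by (simp only: wz_F_0 atMost_atLeast0)
  moreover have "Zp (P * (-1) ^ N * (3 + P * q - (P * q) ^ 2))"
    by (intro Zp_intros Zp_q)
  ultimately show ?thesis
    using sum_wz_F_N unfolding N_def by (simp only: rat_congI)
qed

end
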